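(* Let $\Gamma=\mathrm{SL}_2(\mathbb Z)$, $\nu_{\mathbb H}\begin{pmatrix}a&b\\c&d\end{pmatrix}=a^2+b^2+c^2+d^2$, and for integers $m_1,m_2$ and $n\ge3$ let $$S_e(m_1,m_2,n)=\sum_{\substack{\gamma\in\Gamma\\ \nu_{\mathbb H}(\gamma)=n}}\exp\big(i(2\theta_1(\gamma)m_1+2\theta_2(\gamma)m_2)\big).$$ If $m_1$ or $m_2$ is odd, then $S_e(m_1,m_2,n)=0$. If both are even, then $$S_e(m_1,m_2,n)=\begin{cases}16\,W_{m_1+m_2}(n+2)\,W_{m_1-m_2}(n-2),& n\equiv2\bmod4,\\ 8\,W^P_{m_1+m_2}(n+2)\,W^P_{m_1-m_2}(n-2),& n\equiv3\bmod4,\\ 0,&\text{otherwise.}\end{cases}$$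
   Context: For $\theta\in\mathbb R$, $r\ge0$ let $k(\theta)=\begin{pmatrix}\cos\theta&\sin\theta\\-\sin\theta&\cos\theta\end{pmatrix}$, $a(e^{-r})=\mathrm{diag}(e^{-r/2},e^{r/2})$; each $\gamma$ is written $\gamma=k(\theta_1(\gamma))a(e^{-r})k(\theta_2(\gamma))$ with $r=d_{\mathbb H}(\gamma i,i)>0$ when $\nu_{\mathbb H}(\gamma)>2$, the angles being determined mod $\pi$. $N(z)=z\bar z$; $w\in\mathbb Z[i]$ is primary if $w\equiv1\bmod(1+i)^3$. $W_m(n)=\frac14\sum_{z\in\mathbb Z[i],N(z)=n}(z/|z|)^m$. For odd $n$, $W^P_m(n)=\sum_{z\in\mathbb Z[i],\,N(z)=n,\,z\text{ primary}}(z/|z|)^m$; $W^P_m(2^l)=e^{i\pi lm/4}$; and $W^P_m(2^ln')=W^P_m(2^l)W^P_m(n')$ for $n'$ odd. *)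

theory Defs
  imports "HOL-Analysis.Analysis"
begin

(* Elements of SL_2(Z) as integer 2x2 matrices gamma = [[a,b],[c,d]],
   a = gamma$1$1, b = gamma$1$2, c = gamma$2$1, d = gamma$2$2. *)
definition SL2Z :: "(int^2^2) set" where
  "SL2Z = {g. det g = 1}"

definition nuH :: "int^2^2 \<Rightarrow> int" where
  "nuH g = (g$1$1)^2 + (g$1$2)^2 + (g$2$1)^2 + (g$2$2)^2"

definition to_real_mat :: "int^2^2 \<Rightarrow> real^2^2" where
  "to_real_mat g = (\<chi> i j. real_of_int (g$i$j))"

definition kmat :: "real \<Rightarrow> real^2^2" where
  "kmat t = vector [vector [cos t, sin t], vector [- sin t, cos t]]"

(* a(e^{-r}) = diag(e^{-r/2}, e^{r/2}) *)
definition amat_r :: "real \<Rightarrow> real^2^2" where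
  "amat_r r = vector [vector [exp (- r / 2), 0], vector [0, exp (r / 2)]]"

definition moeb :: "int^2^2 \<Rightarrow> complex \<Rightarrow> complex" where
  "moeb g z = (of_int (g$1$1) * z + of_int (g$1$2)) / (of_int (g$2$1) * z + of_int (g$2$2))"

definition hdist :: "complex \<Rightarrow> complex \<Rightarrow> real" where
  "hdist z w = arcosh (1 + (cmod (z - w))^2 / (2 * Im z * Im w))"

definition kak :: "int^2^2 \<Rightarrow> real \<Rightarrow> real \<Rightarrow> bool" where
  "kak g t1 t2 \<longleftrightarrow>
     to_real_mat g = kmat t1 ** amat_r (hdist (moeb g \<i>) \<i>) ** kmat t2"

(* the angles (theta_1(gamma), theta_2(gamma)), a choice of them (determined mod pi) *)
definition thetas :: "int^2^2 \<Rightarrow> real \<times> real" where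
  "thetas g = (SOME p. kak g (fst p) (snd p))"

definition Se :: "int \<Rightarrow> int \<Rightarrow> nat \<Rightarrow> complex" where
  "Se m1 m2 n = (\<Sum>g\<in>{g\<in>SL2Z. nuH g = int n}.
      exp (\<i> * complex_of_real (2 * fst (thetas g) * of_int m1 + 2 * snd (thetas g) * of_int m2)))"

definition gauss :: "int \<Rightarrow> int \<Rightarrow> complex" where
  "gauss x y = Complex (of_int x) (of_int y)"

definition W :: "int \<Rightarrow> nat \<Rightarrow> complex" where
  "W m n = (1/4) * (\<Sum>(x,y)\<in>{(x::int,y::int). x^2 + y^2 = int n}.
      (gauss x y / complex_of_real (cmod (gauss x y))) powi m)"

definition primary :: "int \<Rightarrow> int \<Rightarrow> bool" where
  "primary x y \<longleftrightarrow> (\<exists>u v. gauss x y - 1 = (1 + \<i>)^3 * gauss u v)"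

definition WP_odd :: "int \<Rightarrow> nat \<Rightarrow> complex" where
  "WP_odd m n = (\<Sum>(x,y)\<in>{(x::int,y::int). x^2 + y^2 = int n \<and> primary x y}.
      (gauss x y / complex_of_real (cmod (gauss x y))) powi m)"

definition WP :: "int \<Rightarrow> nat \<Rightarrow> complex" where
  "WP m n = (let l = multiplicity (2::nat) n; n' = n div 2 ^ l in
      exp (\<i> * complex_of_real (pi * real l * of_int m / 4)) * WP_odd m n')"

end

theory Submission
  imports Defs
begin

text \<open>
  For \<open>\<gamma> = (a b; c d)\<close> put \<open>u = (a + d) + i(b - c)\<close> and \<open>v = (d - a) + i(b + c)\<close>. Then
  \<open>|u|\<^sup>2 = \<nu>(\<gamma>) + 2\<close> and \<open>|v|\<^sup>2 = \<nu>(\<gamma>) - 2\<close>, and \<open>\<gamma> = k(\<theta>\<^sub>1) a(e^-r) k(\<theta>\<^sub>2)\<close> says exactly that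
  \<open>u/|u| = exp(i(\<theta>\<^sub>1 + \<theta>\<^sub>2))\<close> and \<open>v/|v| = exp(i(\<theta>\<^sub>1 - \<theta>\<^sub>2))\<close>. Hence the summand of \<open>S\<^sub>e\<close> is
  \<open>(u/|u|)^(m\<^sub>1 + m\<^sub>2) (v/|v|)^(m\<^sub>1 - m\<^sub>2)\<close>, and \<open>\<gamma> \<mapsto> (u, v)\<close> is a bijection onto the pairs of
  Gaussian integers of norms \<open>n + 2\<close> and \<open>n - 2\<close> that are congruent modulo 2.
  Multiplying both \<open>u\<close> and \<open>v\<close> by \<open>i\<close>, or negating \<open>v\<close>, permutes these pairs and multiplies the
  summand by \<open>(-1)^m\<^sub>1\<close>, resp. \<open>(-1)^(m\<^sub>1 - m\<^sub>2)\<close>, so the sum vanishes unless both \<open>m\<^sub>i\<close> are even.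
  For \<open>n \<equiv> 2 mod 4\<close> all coordinates are even, so the congruence is automatic and the sum
  factorises into two \<open>W\<close>'s. For \<open>n \<equiv> 3 mod 4\<close> the pairs split by the parity of the real
  parts; the two classes differ by a rotation by \<open>i\<close>, and a point with odd real part is,
  up to sign, a unique primary one.
\<close>

section \<open>Arithmetic of sums of squares\<close>

lemma square_mod_4: "\<exists>k. (x::int)\<^sup>2 = 4 * k + (if even x then 0 else 1)"
proof (cases "even x")
  case True
  then obtain k where "x = 2 * k" by blast
  then show ?thesis by (simp add: power2_eq_square)
next
  case False
  then obtain k where "x = 2 * k + 1" by (metis oddE)
  then have "x\<^sup>2 = 4 * (k\<^sup>2 + k) + 1" by (simp add: power2_eq_square algebra_simps)
  then show ?thesis using False by (intro exI[of _ "k\<^sup>2 + k"]) simp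
qed

lemma sum_four_squares_mod_4:
  fixes a b c d :: int
  assumes "odd (a * d - b * c)"
  shows "(a\<^sup>2 + b\<^sup>2 + c\<^sup>2 + d\<^sup>2) mod 4 \<in> {2, 3}"
proof -
  obtain ka kb kc kd where
    k: "a\<^sup>2 = 4 * ka + (if even a then 0 else 1)" "b\<^sup>2 = 4 * kb + (if even b then 0 else 1)"
    "c\<^sup>2 = 4 * kc + (if even c then 0 else 1)" "d\<^sup>2 = 4 * kd + (if even d then 0 else 1)"
    using square_mod_4 by metis
  show ?thesis
    unfolding k using assms by (auto split: if_splits) presburger+
qed

lemma even_if_sum_two_squares_mod_4_eq_0:
  fixes x y :: int
  assumes "(x\<^sup>2 + y\<^sup>2) mod 4 = 0"
  shows "even x \<and> even y"
proof -
  obtain kx ky where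
    k: "x\<^sup>2 = 4 * kx + (if even x then 0 else 1)" "y\<^sup>2 = 4 * ky + (if even y then 0 else 1)"
    using square_mod_4 by metis
  show ?thesis
    using assms unfolding k by (auto split: if_splits) presburger+
qed

lemma odd_norm_parity:
  fixes x y M :: int
  assumes "x\<^sup>2 + y\<^sup>2 = M" and "odd M"
  shows "even y \<longleftrightarrow> odd x"
proof -
  from assms have "odd (x\<^sup>2 + y\<^sup>2)"
    by simp
  then show ?thesis
    by auto
qed

lemma abs_le_power2_int: "\<bar>x\<bar> \<le> (x::int)\<^sup>2"
  using self_le_power[of "\<bar>x\<bar>" 2] by (cases "x = 0") auto

lemma sum_squares_conformal_parts:
  fixes a b c d :: "'a::comm_ring_1"
  shows "(a + d)\<^sup>2 + (b - c)\<^sup>2 = a\<^sup>2 + b\<^sup>2 + c\<^sup>2 + d\<^sup>2 + 2 * (a * d - b * c)"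
    and "(d - a)\<^sup>2 + (b + c)\<^sup>2 = a\<^sup>2 + b\<^sup>2 + c\<^sup>2 + d\<^sup>2 - 2 * (a * d - b * c)"
  by (simp_all add: power2_eq_square algebra_simps)

lemma nuH_mod_4:
  assumes "g \<in> SL2Z"
  shows "nuH g mod 4 \<in> {2, 3}"
proof -
  have "odd (g$1$1 * g$2$2 - g$1$2 * g$2$1)"
    using assms by (simp add: SL2Z_def det_2)
  then show ?thesis
    unfolding nuH_def by (rule sum_four_squares_mod_4)
qed

section \<open>The Cartan decomposition of an element of SL2Z\<close>

lemma hdist_moebius_i:
  fixes a b c d :: real
  assumes det: "a * d - b * c = 1"
  shows "hdist ((of_real a * \<i> + of_real b) / (of_real c * \<i> + of_real d)) \<i>
           = arcosh ((a\<^sup>2 + b\<^sup>2 + c\<^sup>2 + d\<^sup>2) / 2)"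
proof -
  define D where "D = c\<^sup>2 + d\<^sup>2"
  have "D > 0"
    using det by (cases "c = 0") (auto simp: D_def sum_power2_gt_zero_iff)
  define z where "z = (of_real a * \<i> + of_real b) / (of_real c * \<i> + of_real d)"
  have Re_z: "Re z = (b * d + a * c) / D" and Im_z: "Im z = 1 / D"
    using det by (simp_all add: z_def D_def Re_divide Im_divide power2_eq_square algebra_simps)
  have "(b * d + a * c)\<^sup>2 + (a * d - b * c)\<^sup>2 = (a\<^sup>2 + b\<^sup>2) * D"
    by (simp add: D_def power2_eq_square algebra_simps)
  then have lagrange: "(b * d + a * c)\<^sup>2 = (a\<^sup>2 + b\<^sup>2) * D - 1"
    using det by simp
  have "Im z - 1 = (1 - D) / D"
    using \<open>D > 0\<close> by (simp add: Im_z field_simps)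
  then have "(cmod (z - \<i>))\<^sup>2 = ((b * d + a * c) / D)\<^sup>2 + ((1 - D) / D)\<^sup>2"
    by (simp add: cmod_power2 Re_z)
  also have "\<dots> = ((b * d + a * c)\<^sup>2 + (1 - D)\<^sup>2) / D\<^sup>2"
    by (simp add: power_divide flip: add_divide_distrib)
  finally have "1 + (cmod (z - \<i>))\<^sup>2 / (2 * Im z * Im \<i>) = 1 + ((b * d + a * c)\<^sup>2 + (1 - D)\<^sup>2) / (2 * D)"
    using \<open>D > 0\<close> by (simp add: Im_z field_simps power2_eq_square)
  also have "\<dots> = (a\<^sup>2 + b\<^sup>2 + c\<^sup>2 + d\<^sup>2) / 2"
    using \<open>D > 0\<close> unfolding lagrange by (simp add: D_def field_simps power2_eq_square)
  finally show ?thesis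
    unfolding hdist_def z_def[symmetric] by (rule arg_cong)
qed

lemma hdist_moeb_i:
  assumes "g \<in> SL2Z"
  shows "hdist (moeb g \<i>) \<i> = arcosh (real_of_int (nuH g) / 2)"
proof -
  have "real_of_int (g$1$1) * real_of_int (g$2$2) - real_of_int (g$1$2) * real_of_int (g$2$1) = 1"
    using assms by (simp add: SL2Z_def det_2 flip: of_int_mult of_int_diff)
  from hdist_moebius_i[OF this] show ?thesis
    by (simp add: moeb_def nuH_def)
qed

lemma kmat_amat_kmat_iff:
  fixes M :: "real^2^2"
  shows "M = kmat t1 ** amat_r r ** kmat t2 \<longleftrightarrow>
    Complex (M$1$1 + M$2$2) (M$1$2 - M$2$1) = complex_of_real (exp (-r/2) + exp (r/2)) * cis (t1 + t2) \<and>
    Complex (M$2$2 - M$1$1) (M$1$2 + M$2$1) = complex_of_real (exp (r/2) - exp (-r/2)) * cis (t1 - t2)"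
    (is "_ \<longleftrightarrow> ?conformal \<and> ?anticonformal")
proof -
  define \<alpha> \<beta> where "\<alpha> = exp (-r/2)" and "\<beta> = exp (r/2)"
  have "M = kmat t1 ** amat_r r ** kmat t2 \<longleftrightarrow>
     M$1$1 = cos t1 * \<alpha> * cos t2 - sin t1 * \<beta> * sin t2 \<and>
     M$1$2 = cos t1 * \<alpha> * sin t2 + sin t1 * \<beta> * cos t2 \<and>
     M$2$1 = - sin t1 * \<alpha> * cos t2 - cos t1 * \<beta> * sin t2 \<and>
     M$2$2 = - sin t1 * \<alpha> * sin t2 + cos t1 * \<beta> * cos t2"
    by (simp add: vec_eq_iff forall_2 matrix_matrix_mult_def kmat_def amat_r_def sum_2
        algebra_simps \<alpha>_def \<beta>_def)
  also have "\<dots> \<longleftrightarrow> ?conformal \<and> ?anticonformal"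
    unfolding \<alpha>_def[symmetric] \<beta>_def[symmetric]
    by (simp add: complex_eq_iff cos_add sin_add cos_diff sin_diff algebra_simps) linarith
  finally show ?thesis .
qed

lemma exp_half_arcosh:
  fixes x :: real
  assumes "x \<ge> 2"
  defines "r \<equiv> arcosh (x / 2)"
  shows "exp (-r/2) + exp (r/2) = sqrt (x + 2)" and "exp (r/2) - exp (-r/2) = sqrt (x - 2)"
proof -
  have "cosh r = x / 2"
    using assms by (simp add: r_def)
  then have "exp (-r) + exp r = x"
    by (simp add: cosh_def)
  moreover have "exp (-r/2) * exp (r/2) = 1" "(exp (-r/2))\<^sup>2 = exp (-r)" "(exp (r/2))\<^sup>2 = exp r"
    by (simp_all add: power2_eq_square flip: exp_add)
  ultimately have "(exp (-r/2) + exp (r/2))\<^sup>2 = x + 2" "(exp (r/2) - exp (-r/2))\<^sup>2 = x - 2"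
    by (simp_all add: power2_sum power2_diff algebra_simps)
  moreover have "exp (-r/2) \<le> exp (r/2)"
    using assms by (simp add: r_def)
  ultimately show "exp (-r/2) + exp (r/2) = sqrt (x + 2)" "exp (r/2) - exp (-r/2) = sqrt (x - 2)"
    by (simp_all add: real_sqrt_unique)
qed

lemma conformal_parts_SL2Z:
  assumes "g \<in> SL2Z"
  shows "(g$1$1 + g$2$2)\<^sup>2 + (g$1$2 - g$2$1)\<^sup>2 = nuH g + 2"
    and "(g$2$2 - g$1$1)\<^sup>2 + (g$1$2 + g$2$1)\<^sup>2 = nuH g - 2"
  using assms sum_squares_conformal_parts[where a = "g$1$1" and b = "g$1$2" and c = "g$2$1" and d = "g$2$2"]
  by (simp_all add: SL2Z_def det_2 nuH_def)

lemma cmod_gauss: "cmod (gauss x y) = sqrt (real_of_int (x\<^sup>2 + y\<^sup>2))"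
  by (simp add: gauss_def cmod_def)

lemma cmod_conformal_parts_SL2Z:
  assumes "g \<in> SL2Z"
  shows "cmod (gauss (g$1$1 + g$2$2) (g$1$2 - g$2$1)) = sqrt (real_of_int (nuH g) + 2)"
    and "cmod (gauss (g$2$2 - g$1$1) (g$1$2 + g$2$1)) = sqrt (real_of_int (nuH g) - 2)"
  unfolding cmod_gauss conformal_parts_SL2Z[OF assms] by simp_all

lemma sgn_eq_cis_iff: "z \<noteq> 0 \<Longrightarrow> sgn z = cis t \<longleftrightarrow> z = complex_of_real (cmod z) * cis t"
  by (auto simp: sgn_eq field_simps)

lemma kak_iff_sgn:
  assumes "g \<in> SL2Z" and "nuH g \<ge> 3"
  shows "kak g t1 t2 \<longleftrightarrow>
           sgn (gauss (g$1$1 + g$2$2) (g$1$2 - g$2$1)) = cis (t1 + t2) \<and>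
           sgn (gauss (g$2$2 - g$1$1) (g$1$2 + g$2$1)) = cis (t1 - t2)"
proof -
  define u v where "u = gauss (g$1$1 + g$2$2) (g$1$2 - g$2$1)"
    and "v = gauss (g$2$2 - g$1$1) (g$1$2 + g$2$1)"
  define x where "x = real_of_int (nuH g)"
  have "cmod u = sqrt (x + 2)" "cmod v = sqrt (x - 2)"
    using cmod_conformal_parts_SL2Z[OF assms(1)] by (simp_all add: u_def v_def x_def)
  moreover have "x \<ge> 3"
    using assms(2) by (simp add: x_def)
  ultimately have "u \<noteq> 0" "v \<noteq> 0"
    by auto
  have "kak g t1 t2 \<longleftrightarrow>
          u = complex_of_real (sqrt (x + 2)) * cis (t1 + t2) \<and>
          v = complex_of_real (sqrt (x - 2)) * cis (t1 - t2)"
    using \<open>x \<ge> 3\<close> exp_half_arcosh[of x]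
    by (simp add: kak_def kmat_amat_kmat_iff hdist_moeb_i[OF assms(1)] x_def u_def v_def
        gauss_def to_real_mat_def)
  also have "\<dots> \<longleftrightarrow> sgn u = cis (t1 + t2) \<and> sgn v = cis (t1 - t2)"
    using \<open>u \<noteq> 0\<close> \<open>v \<noteq> 0\<close> \<open>cmod u = sqrt (x + 2)\<close> \<open>cmod v = sqrt (x - 2)\<close>
    by (simp add: sgn_eq_cis_iff)
  finally show ?thesis
    by (simp add: u_def v_def)
qed

lemma kak_thetas:
  assumes "g \<in> SL2Z" and "nuH g \<ge> 3"
  shows "kak g (fst (thetas g)) (snd (thetas g))"
proof -
  define u v where "u = gauss (g$1$1 + g$2$2) (g$1$2 - g$2$1)"
    and "v = gauss (g$2$2 - g$1$1) (g$1$2 + g$2$1)"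
  have "u \<noteq> 0" "v \<noteq> 0"
    using assms(2) cmod_conformal_parts_SL2Z[OF assms(1)] by (auto simp flip: u_def v_def)
  then have "kak g ((Arg u + Arg v) / 2) ((Arg u - Arg v) / 2)"
    by (simp add: kak_iff_sgn[OF assms] cis_Arg flip: u_def v_def add_divide_distrib diff_divide_distrib)
  then have "\<exists>p. kak g (fst p) (snd p)"
    by auto
  then show ?thesis
    unfolding thetas_def by (rule someI_ex)
qed

section \<open>Se as a sum over pairs of Gaussian integers\<close>

definition angular_char :: "int \<Rightarrow> int \<times> int \<Rightarrow> complex" where
  "angular_char m = (\<lambda>(x, y). sgn (gauss x y) powi m)"

definition pair_char :: "int \<Rightarrow> int \<Rightarrow> (int \<times> int) \<times> (int \<times> int) \<Rightarrow> complex" where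
  "pair_char p q = (\<lambda>(u, v). angular_char p u * angular_char q v)"

definition gaussian_pair :: "int^2^2 \<Rightarrow> (int \<times> int) \<times> (int \<times> int)" where
  "gaussian_pair g = ((g$1$1 + g$2$2, g$1$2 - g$2$1), (g$2$2 - g$1$1, g$1$2 + g$2$1))"

lemma Se_summand_eq_pair_char:
  assumes "g \<in> SL2Z" and "nuH g \<ge> 3"
  shows "exp (\<i> * complex_of_real (2 * fst (thetas g) * of_int m1 + 2 * snd (thetas g) * of_int m2))
           = pair_char (m1 + m2) (m1 - m2) (gaussian_pair g)"
proof -
  obtain t1 t2 where t: "thetas g = (t1, t2)"
    by fastforce
  have "sgn (gauss (g$1$1 + g$2$2) (g$1$2 - g$2$1)) = cis (t1 + t2)"
       "sgn (gauss (g$2$2 - g$1$1) (g$1$2 + g$2$1)) = cis (t1 - t2)"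
    using kak_thetas[OF assms] by (simp_all add: t kak_iff_sgn[OF assms])
  then have "pair_char (m1 + m2) (m1 - m2) (gaussian_pair g)
               = cis (of_int (m1 + m2) * (t1 + t2) + of_int (m1 - m2) * (t1 - t2))"
    by (simp add: pair_char_def angular_char_def gaussian_pair_def cis_power_int cis_mult)
  also have "\<dots> = exp (\<i> * complex_of_real (2 * t1 * of_int m1 + 2 * t2 * of_int m2))"
    by (simp add: cis_conv_exp algebra_simps)
  finally show ?thesis
    by (simp add: t)
qed

lemma Se_eq_sum_pair_char:
  assumes "n \<ge> 3"
  shows "Se m1 m2 n = (\<Sum>g\<in>{g \<in> SL2Z. nuH g = int n}. pair_char (m1 + m2) (m1 - m2) (gaussian_pair g))"
  unfolding Se_def using assms by (intro sum.cong refl Se_summand_eq_pair_char) auto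

definition gaussian_pairs :: "int \<Rightarrow> ((int \<times> int) \<times> (int \<times> int)) set" where
  "gaussian_pairs N = {((x1, y1), (x2, y2)).
     x1\<^sup>2 + y1\<^sup>2 = N + 2 \<and> x2\<^sup>2 + y2\<^sup>2 = N - 2 \<and> even (x1 - x2) \<and> even (y1 - y2)}"

(* The parity conditions in gaussian_pairs make these divisions exact. *)
definition gaussian_pair_inv :: "(int \<times> int) \<times> (int \<times> int) \<Rightarrow> int^2^2" where
  "gaussian_pair_inv = (\<lambda>((x1, y1), (x2, y2)).
     vector [vector [(x1 - x2) div 2, (y1 + y2) div 2], vector [(y2 - y1) div 2, (x1 + x2) div 2]])"

lemma gaussian_pair_inv_inverse:
  assumes "e \<in> gaussian_pairs N"
  shows "gaussian_pair (gaussian_pair_inv e) = e" and "gaussian_pair_inv e \<in> {g \<in> SL2Z. nuH g = N}"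
proof -
  obtain x1 y1 x2 y2 where e: "e = ((x1, y1), (x2, y2))"
    by (metis prod.exhaust)
  define M where "M = gaussian_pair_inv e"
  have norms: "x1\<^sup>2 + y1\<^sup>2 = N + 2" "x2\<^sup>2 + y2\<^sup>2 = N - 2" and "even (x1 - x2)" "even (y1 - y2)"
    using assms by (auto simp: gaussian_pairs_def e)
  then obtain a b where "x1 - x2 = 2 * a" "y1 + y2 = 2 * b"
    by (metis dvdE even_diff)
  then have "M$1$1 = a" "M$1$2 = b" "M$2$1 = b - y1" "M$2$2 = x1 - a" "x2 = x1 - 2 * a" "y2 = 2 * b - y1"
    by (auto simp: M_def gaussian_pair_inv_def e)
  then show pair: "gaussian_pair M = e"
    by (simp add: gaussian_pair_def e)
  have "nuH M + 2 * det M = N + 2" "nuH M - 2 * det M = N - 2"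
    using sum_squares_conformal_parts[where a = "M$1$1" and b = "M$1$2" and c = "M$2$1" and d = "M$2$2"]
      norms pair by (simp_all add: gaussian_pair_def e nuH_def det_2)
  then show "M \<in> {g \<in> SL2Z. nuH g = N}"
    by (simp add: SL2Z_def)
qed

lemma bij_betw_gaussian_pair: "bij_betw gaussian_pair {g \<in> SL2Z. nuH g = N} (gaussian_pairs N)"
proof (rule bij_betw_byWitness[where f' = gaussian_pair_inv])
  show "\<forall>g\<in>{g \<in> SL2Z. nuH g = N}. gaussian_pair_inv (gaussian_pair g) = g"
    by (simp add: gaussian_pair_def gaussian_pair_inv_def vec_eq_iff forall_2)
  show "gaussian_pair ` {g \<in> SL2Z. nuH g = N} \<subseteq> gaussian_pairs N"
    by (auto simp: gaussian_pairs_def gaussian_pair_def conformal_parts_SL2Z)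
  show "\<forall>e\<in>gaussian_pairs N. gaussian_pair (gaussian_pair_inv e) = e"
    and "gaussian_pair_inv ` gaussian_pairs N \<subseteq> {g \<in> SL2Z. nuH g = N}"
    using gaussian_pair_inv_inverse by blast+
qed

lemma Se_eq_sum_gaussian_pairs:
  assumes "n \<ge> 3"
  shows "Se m1 m2 n = sum (pair_char (m1 + m2) (m1 - m2)) (gaussian_pairs (int n))"
  using Se_eq_sum_pair_char[OF assms] sum.reindex_bij_betw[OF bij_betw_gaussian_pair] by simp

lemma Se_eq_0_if_not_2_3_mod_4:
  assumes "n mod 4 \<noteq> 2" and "n mod 4 \<noteq> 3"
  shows "Se m1 m2 n = 0"
proof -
  have "int n mod 4 \<noteq> 2" "int n mod 4 \<noteq> 3"
    using assms by presburger+
  then have "{g \<in> SL2Z. nuH g = int n} = {}"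
    by (fastforce dest: nuH_mod_4)
  then show ?thesis
    unfolding Se_def by (simp only: sum.empty)
qed

lemma sum_pair_char_Times:
  "sum (pair_char p q) (A \<times> B) = sum (angular_char p) A * sum (angular_char q) B"
  by (simp add: pair_char_def sum_product sum.cartesian_product)

definition lattice_circle :: "int \<Rightarrow> (int \<times> int) set" where
  "lattice_circle N = {(x, y). x\<^sup>2 + y\<^sup>2 = N}"

lemma finite_lattice_circle: "finite (lattice_circle N)"
proof (rule finite_subset)
  show "lattice_circle N \<subseteq> {-N..N} \<times> {-N..N}"
  proof
    fix z
    assume "z \<in> lattice_circle N"
    then obtain x y where z: "z = (x, y)" and "x\<^sup>2 + y\<^sup>2 = N"
      by (auto simp: lattice_circle_def)
    then have "\<bar>x\<bar> \<le> N" "\<bar>y\<bar> \<le> N"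
      using abs_le_power2_int[of x] abs_le_power2_int[of y] zero_le_power2[of x] zero_le_power2[of y]
      by linarith+
    then show "z \<in> {-N..N} \<times> {-N..N}"
      by (simp add: z abs_le_iff)
  qed
qed simp

lemma finite_gaussian_pairs: "finite (gaussian_pairs N)"
proof (rule finite_subset)
  show "gaussian_pairs N \<subseteq> lattice_circle (N + 2) \<times> lattice_circle (N - 2)"
    by (auto simp: gaussian_pairs_def lattice_circle_def)
qed (simp add: finite_lattice_circle)

section \<open>Symmetries under the units of Z[i]\<close>

lemma ii_powi_double: "\<i> powi (2 * k) = (-1) powi k"
proof -
  have "\<i> powi (2 * k) = (\<i> powi 2) powi k"
    by (rule power_int_mult)
  then show ?thesis
    by simp
qed

lemma angular_char_rotate: "angular_char m (-y, x) = \<i> powi m * angular_char m (x, y)"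
proof -
  have "gauss (-y) x = \<i> * gauss x y"
    by (simp add: gauss_def complex_eq_iff)
  moreover have "sgn \<i> = \<i>"
    by (simp add: sgn_eq)
  ultimately have "sgn (gauss (-y) x) = \<i> * sgn (gauss x y)"
    by (simp only: sgn_mult)
  then show ?thesis
    unfolding angular_char_def by (simp only: case_prod_conv power_int_mult_distrib)
qed

lemma angular_char_uminus: "angular_char m (-x, -y) = (-1) powi m * angular_char m (x, y)"
proof -
  have "gauss (-x) (-y) = - gauss x y"
    by (simp add: gauss_def complex_eq_iff)
  then have "sgn (gauss (-x) (-y)) = (-1) * sgn (gauss x y)"
    by (simp only: sgn_minus mult_minus1)
  then show ?thesis
    unfolding angular_char_def by (simp only: case_prod_conv power_int_mult_distrib)
qed

lemma sum_angular_char_rotate: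
  "sum (angular_char m) ((\<lambda>(x, y). (-y, x)) ` A) = \<i> powi m * sum (angular_char m) A"
proof -
  have "sum (angular_char m) ((\<lambda>(x, y). (-y, x)) ` A) = sum (angular_char m \<circ> (\<lambda>(x, y). (-y, x))) A"
    by (rule sum.reindex) (auto simp: inj_on_def)
  also have "\<dots> = sum (\<lambda>z. \<i> powi m * angular_char m z) A"
    by (rule sum.cong) (auto simp: angular_char_rotate)
  finally show ?thesis
    by (simp add: sum_distrib_left)
qed

lemma sum_angular_char_uminus:
  "sum (angular_char m) ((\<lambda>(x, y). (-x, -y)) ` A) = (-1) powi m * sum (angular_char m) A"
proof -
  have "sum (angular_char m) ((\<lambda>(x, y). (-x, -y)) ` A) = sum (angular_char m \<circ> (\<lambda>(x, y). (-x, -y))) A"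
    by (rule sum.reindex) (auto simp: inj_on_def)
  also have "\<dots> = sum (\<lambda>z. (-1) powi m * angular_char m z) A"
    by (rule sum.cong) (auto simp: angular_char_uminus)
  finally show ?thesis
    by (simp add: sum_distrib_left)
qed

lemma pair_char_rotate:
  "pair_char p q ((-y1, x1), (-y2, x2)) = \<i> powi (p + q) * pair_char p q ((x1, y1), (x2, y2))"
  by (simp add: pair_char_def angular_char_rotate power_int_add mult_ac)

lemma pair_char_uminus_snd:
  "pair_char p q (u, (-x2, -y2)) = (-1) powi q * pair_char p q (u, (x2, y2))"
  by (simp add: pair_char_def angular_char_uminus split: prod.split)

lemma sum_eq_0_if_twisted_symmetry:
  fixes f :: "'a \<Rightarrow> 'b::idom"
  assumes "finite A" and "inj_on \<sigma> A" and "\<sigma> ` A \<subseteq> A"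
    and "\<And>x. x \<in> A \<Longrightarrow> f (\<sigma> x) = c * f x" and "c \<noteq> 1"
  shows "sum f A = 0"
proof -
  have "sum f A = sum f (\<sigma> ` A)"
    using endo_inj_surj[OF assms(1,3,2)] by simp
  also have "\<dots> = c * sum f A"
    using assms(2,4) by (simp add: sum.reindex sum_distrib_left)
  finally have "(1 - c) * sum f A = 0"
    by (simp add: algebra_simps)
  then show ?thesis
    using assms(5) by simp
qed

lemma sum_pair_char_eq_0_if_odd:
  assumes "odd m1 \<or> odd m2"
  shows "sum (pair_char (m1 + m2) (m1 - m2)) (gaussian_pairs N) = 0"
proof (cases "odd m1")
  case True
  have c: "\<i> powi (2 * m1) = -1"
    using True by (simp add: ii_powi_double)
  show ?thesis
    by (rule sum_eq_0_if_twisted_symmetry[OF finite_gaussian_pairs,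
          where \<sigma> = "\<lambda>((x1, y1), (x2, y2)). ((-y1, x1), (-y2, x2))" and c = "\<i> powi (m1 + m2 + (m1 - m2))"])
       (auto simp: inj_on_def gaussian_pairs_def pair_char_rotate c)
next
  case False
  then have c: "(-1) powi (m1 - m2) = (-1 :: complex)"
    using assms by simp
  show ?thesis
    by (rule sum_eq_0_if_twisted_symmetry[OF finite_gaussian_pairs,
          where \<sigma> = "\<lambda>(u, (x2, y2)). (u, (-x2, -y2))" and c = "(-1) powi (m1 - m2)"])
       (auto simp: inj_on_def gaussian_pairs_def pair_char_uminus_snd c)
qed

lemma Se_eq_0_if_odd:
  assumes "n \<ge> 3" and "odd m1 \<or> odd m2"
  shows "Se m1 m2 n = 0"
  using assms by (simp add: Se_eq_sum_gaussian_pairs sum_pair_char_eq_0_if_odd)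

section \<open>The case \<open>n \<equiv> 2 mod 4\<close>\<close>

lemma W_eq_sum_angular_char: "W m n = 1 / 4 * sum (angular_char m) (lattice_circle (int n))"
  unfolding W_def angular_char_def lattice_circle_def sgn_eq ..

lemma gaussian_pairs_2_mod_4:
  assumes "N mod 4 = 2"
  shows "gaussian_pairs N = lattice_circle (N + 2) \<times> lattice_circle (N - 2)"
proof -
  have "(N + 2) mod 4 = 0" "(N - 2) mod 4 = 0"
    using assms by presburger+
  then have "even x1 \<and> even y1 \<and> even x2 \<and> even y2"
    if "x1\<^sup>2 + y1\<^sup>2 = N + 2" "x2\<^sup>2 + y2\<^sup>2 = N - 2" for x1 y1 x2 y2 :: int
    using that even_if_sum_two_squares_mod_4_eq_0[of x1 y1] even_if_sum_two_squares_mod_4_eq_0[of x2 y2]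
    by simp
  then show ?thesis
    by (auto simp: gaussian_pairs_def lattice_circle_def)
qed

lemma Se_2_mod_4:
  assumes "n \<ge> 3" and "n mod 4 = 2"
  shows "Se m1 m2 n = 16 * W (m1 + m2) (n + 2) * W (m1 - m2) (n - 2)"
proof -
  have "int n mod 4 = 2" and casts: "int (n + 2) = int n + 2" "int (n - 2) = int n - 2"
    using assms by presburger+
  then show ?thesis
    unfolding Se_eq_sum_gaussian_pairs[OF assms(1)] gaussian_pairs_2_mod_4[OF \<open>int n mod 4 = 2\<close>]
      sum_pair_char_Times W_eq_sum_angular_char casts
    by simp
qed

section \<open>The case \<open>n \<equiv> 3 mod 4\<close>\<close>

lemma gauss_eq_iff: "gauss a b = gauss c d \<longleftrightarrow> a = c \<and> b = d"
  by (simp add: gauss_def complex_eq_iff)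

lemma primary_iff: "primary x y \<longleftrightarrow> even y \<and> 4 dvd (y - x + 1)"
proof -
  have "(1 + \<i>) ^ 3 = Complex (-2) 2"
    by (simp add: power3_eq_cube complex_eq_iff)
  then have "(1 + \<i>) ^ 3 * gauss u v = gauss (-2 * u - 2 * v) (2 * u - 2 * v)" for u v
    by (simp add: gauss_def complex_eq_iff)
  moreover have "gauss x y - 1 = gauss (x - 1) y"
    by (simp add: gauss_def complex_eq_iff)
  ultimately have "primary x y \<longleftrightarrow> (\<exists>u v. x - 1 = -2 * u - 2 * v \<and> y = 2 * u - 2 * v)"
    by (simp only: primary_def gauss_eq_iff)
  also have "\<dots> \<longleftrightarrow> even y \<and> 4 dvd (y - x + 1)"
    by presburger
  finally show ?thesis .
qed

definition primary_points :: "int \<Rightarrow> (int \<times> int) set" where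
  "primary_points N = {(x, y). x\<^sup>2 + y\<^sup>2 = N \<and> primary x y}"

lemma finite_primary_points: "finite (primary_points N)"
  by (rule finite_subset[OF _ finite_lattice_circle[of N]]) (auto simp: primary_points_def lattice_circle_def)

lemma WP_eq_sum_angular_char:
  assumes "odd n"
  shows "WP m n = sum (angular_char m) (primary_points (int n))"
proof -
  have "multiplicity 2 n = 0"
    using assms by (simp add: not_dvd_imp_multiplicity_0)
  then have "WP m n = WP_odd m n"
    by (simp add: WP_def)
  also have "\<dots> = sum (angular_char m) (primary_points (int n))"
    unfolding WP_odd_def angular_char_def primary_points_def sgn_eq ..
  finally show ?thesis .
qed

lemma rotate_odd_fst:
  assumes "odd N"
  shows "(\<lambda>(x, y). (-y, x)) ` {z \<in> lattice_circle N. odd (fst z)} = {z \<in> lattice_circle N. even (fst z)}"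
proof (intro equalityI subsetI)
  fix z
  assume "z \<in> (\<lambda>(x, y). (-y, x)) ` {z \<in> lattice_circle N. odd (fst z)}"
  then obtain x y where "z = (-y, x)" "x\<^sup>2 + y\<^sup>2 = N" "odd x"
    by (auto simp: lattice_circle_def)
  moreover have "even y"
    using assms odd_norm_parity calculation by blast
  ultimately show "z \<in> {z \<in> lattice_circle N. even (fst z)}"
    by (simp add: lattice_circle_def add.commute)
next
  fix z
  assume "z \<in> {z \<in> lattice_circle N. even (fst z)}"
  then obtain x y where z: "z = (x, y)" "x\<^sup>2 + y\<^sup>2 = N" "even x"
    by (auto simp: lattice_circle_def)
  moreover have "odd y"
    using assms odd_norm_parity calculation by blast
  ultimately have "(y, -x) \<in> {z \<in> lattice_circle N. odd (fst z)}" and "z = (\<lambda>(x, y). (-y, x)) (y, -x)"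
    by (simp_all add: lattice_circle_def add.commute)
  then show "z \<in> (\<lambda>(x, y). (-y, x)) ` {z \<in> lattice_circle N. odd (fst z)}"
    by blast
qed

lemma odd_fst_eq_primary_points_union:
  assumes "odd N"
  shows "{z \<in> lattice_circle N. odd (fst z)} = primary_points N \<union> (\<lambda>(x, y). (-x, -y)) ` primary_points N"
proof (intro equalityI subsetI)
  fix z
  assume "z \<in> {z \<in> lattice_circle N. odd (fst z)}"
  then obtain x y where z: "z = (x, y)" "x\<^sup>2 + y\<^sup>2 = N" "odd x"
    by (auto simp: lattice_circle_def)
  then have "even y"
    using assms odd_norm_parity by blast
  then have "primary x y \<or> primary (-x) (-y)"
    using \<open>odd x\<close> unfolding primary_iff by presburger
  then show "z \<in> primary_points N \<union> (\<lambda>(x, y). (-x, -y)) ` primary_points N"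
    using z by (force simp: primary_points_def image_iff)
next
  fix z
  assume "z \<in> primary_points N \<union> (\<lambda>(x, y). (-x, -y)) ` primary_points N"
  then obtain x y where z: "z = (x, y)" "x\<^sup>2 + y\<^sup>2 = N" and "primary x y \<or> primary (-x) (-y)"
    by (auto simp: primary_points_def)
  then have "odd x"
    unfolding primary_iff by presburger
  then show "z \<in> {z \<in> lattice_circle N. odd (fst z)}"
    using z by (simp add: lattice_circle_def)
qed

lemma primary_points_disjoint_uminus:
  "primary_points N \<inter> (\<lambda>(x, y). (-x, -y)) ` primary_points N = {}"
proof -
  have "\<not> (primary x y \<and> primary (-x) (-y))" for x y
    unfolding primary_iff by presburger
  then show ?thesis
    by (auto simp: primary_points_def)
qed

lemma sum_angular_char_odd_fst:
  assumes "odd N" and "even m"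
  shows "sum (angular_char m) {z \<in> lattice_circle N. odd (fst z)} = 2 * sum (angular_char m) (primary_points N)"
proof -
  have "sum (angular_char m) {z \<in> lattice_circle N. odd (fst z)}
          = sum (angular_char m) (primary_points N) + sum (angular_char m) ((\<lambda>(x, y). (-x, -y)) ` primary_points N)"
    unfolding odd_fst_eq_primary_points_union[OF assms(1)]
    by (rule sum.union_disjoint) (simp_all add: finite_primary_points primary_points_disjoint_uminus)
  then show ?thesis
    using assms(2) by (simp add: sum_angular_char_uminus)
qed

lemma gaussian_pairs_odd:
  assumes "odd N"
  shows "gaussian_pairs N =
           {z \<in> lattice_circle (N + 2). odd (fst z)} \<times> {z \<in> lattice_circle (N - 2). odd (fst z)} \<union>
           {z \<in> lattice_circle (N + 2). even (fst z)} \<times> {z \<in> lattice_circle (N - 2). even (fst z)}"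
proof -
  have "odd (N + 2)" "odd (N - 2)"
    using assms by simp_all
  then show ?thesis
    by (auto simp: gaussian_pairs_def lattice_circle_def dest: odd_norm_parity)
qed

lemma sum_pair_char_odd:
  assumes "odd N" and "even m1" and "even m2"
  shows "sum (pair_char (m1 + m2) (m1 - m2)) (gaussian_pairs N)
           = 8 * sum (angular_char (m1 + m2)) (primary_points (N + 2)) * sum (angular_char (m1 - m2)) (primary_points (N - 2))"
proof -
  define p q where "p = m1 + m2" and "q = m1 - m2"
  define Odd Even where "Odd M = {z \<in> lattice_circle M. odd (fst z)}"
    and "Even M = {z \<in> lattice_circle M. even (fst z)}" for M
  have "odd (N + 2)" "odd (N - 2)" "even p" "even q"
    using assms by (simp_all add: p_def q_def)
  have "\<i> powi p * \<i> powi q = \<i> powi (2 * m1)"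
    by (simp add: p_def q_def flip: power_int_add)
  then have unit: "\<i> powi p * \<i> powi q = 1"
    using assms(2) by (simp add: ii_powi_double)
  have "finite (Odd M)" "finite (Even M)" for M
    by (simp_all add: Odd_def Even_def finite_lattice_circle)
  moreover have "Odd (N + 2) \<times> Odd (N - 2) \<inter> Even (N + 2) \<times> Even (N - 2) = {}"
    by (auto simp: Odd_def Even_def)
  ultimately have "sum (pair_char p q) (gaussian_pairs N)
      = sum (pair_char p q) (Odd (N + 2) \<times> Odd (N - 2)) + sum (pair_char p q) (Even (N + 2) \<times> Even (N - 2))"
    unfolding gaussian_pairs_odd[OF assms(1)] Odd_def[symmetric] Even_def[symmetric]
    by (intro sum.union_disjoint) auto
  also have "\<dots> = (1 + \<i> powi p * \<i> powi q) * (sum (angular_char p) (Odd (N + 2)) * sum (angular_char q) (Odd (N - 2)))"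
    unfolding sum_pair_char_Times Even_def rotate_odd_fst[OF \<open>odd (N + 2)\<close>, symmetric]
      rotate_odd_fst[OF \<open>odd (N - 2)\<close>, symmetric] sum_angular_char_rotate Odd_def[symmetric]
    by (simp add: algebra_simps)
  also have "\<dots> = 8 * sum (angular_char p) (primary_points (N + 2)) * sum (angular_char q) (primary_points (N - 2))"
    unfolding unit Odd_def sum_angular_char_odd_fst[OF \<open>odd (N + 2)\<close> \<open>even p\<close>]
      sum_angular_char_odd_fst[OF \<open>odd (N - 2)\<close> \<open>even q\<close>]
    by simp
  finally show ?thesis
    by (simp add: p_def q_def)
qed

lemma Se_3_mod_4:
  assumes "n \<ge> 3" and "n mod 4 = 3" and "even m1" and "even m2"
  shows "Se m1 m2 n = 8 * WP (m1 + m2) (n + 2) * WP (m1 - m2) (n - 2)"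
proof -
  have "odd (int n)" "odd (n + 2)" "odd (n - 2)"
    and casts: "int (n + 2) = int n + 2" "int (n - 2) = int n - 2"
    using assms(1,2) by presburger+
  then show ?thesis
    unfolding Se_eq_sum_gaussian_pairs[OF assms(1)] sum_pair_char_odd[OF \<open>odd (int n)\<close> assms(3,4)]
      WP_eq_sum_angular_char[OF \<open>odd (n + 2)\<close>] WP_eq_sum_angular_char[OF \<open>odd (n - 2)\<close>] casts
    by simp
qed

theorem lemma3p6:
  fixes m1 m2 :: int and n :: nat
  assumes "n \<ge> 3"
  shows "(odd m1 \<or> odd m2 \<longrightarrow> Se m1 m2 n = 0) \<and>
         (even m1 \<and> even m2 \<longrightarrow>
            Se m1 m2 n =
              (if n mod 4 = 2 then 16 * W (m1 + m2) (n + 2) * W (m1 - m2) (n - 2)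
               else if n mod 4 = 3 then 8 * WP (m1 + m2) (n + 2) * WP (m1 - m2) (n - 2)
               else 0))"
  using assms Se_eq_0_if_odd Se_2_mod_4 Se_3_mod_4 Se_eq_0_if_not_2_3_mod_4 by auto

end
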